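(* Let $\mathcal{H}$ be a complex separable Hilbert space, let $A\in\mathcal{B}(\mathcal{H})$ be an invertible normal operator, and let $\mathcal{G}$ be a countable system of vectors in $\mathcal{H}$. Then, for any finite positive number $L$, $\{A^tg\}_{g\in\mathcal{G},\,t\in[0,L]}$ is a Bessel system in $\mathcal{H}$ if and only if $\mathcal{G}$ is a Bessel system in $\mathcal{H}$.
   Context: Invertible means having a bounded inverse. $\mathcal{G}$ is a Bessel system in $\mathcal{H}$ if there is $C>0$ with $\sum_{g\in\mathcal{G}}|\langle f,g\rangle|^2\le C\|f\|^2$ for all $f\in\mathcal{H}$. $\{A^tg\}_{g\in\mathcal{G},t\in[0,L]}$ is a Bessel system in $\mathcal{H}$ if there is $C>0$ with $\sum_{g\in\mathcal{G}}\int_0^L|\langle f,A^tg\rangle|^2dt\le C\|f\|^2$ for all $f\in\mathcal{H}$. For an invertible normal operator $A$ with spectral measure $E$, $A^t=\int_{\sigma(A)}z^t\,dE(z)$, where $z^t=\exp(t(\ln|z|+i\arg z))$ with $\arg z\in[-\pi,\pi)$. *)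

theory Defs
  imports "HOL-Analysis.Analysis"
begin

section \<open>Complex Hilbert spaces\<close>

class scaleC = scaleR +
  fixes scaleC :: "complex \<Rightarrow> 'a \<Rightarrow> 'a"  (infixr \<open>*\<^sub>C\<close> 75)
  assumes scaleR_scaleC: "r *\<^sub>R x = complex_of_real r *\<^sub>C x"

class complex_normed_vector = real_normed_vector + scaleC +
  assumes scaleC_add_right: "c *\<^sub>C (x + y) = c *\<^sub>C x + c *\<^sub>C y"
    and scaleC_add_left: "(c + d) *\<^sub>C x = c *\<^sub>C x + d *\<^sub>C x"
    and scaleC_scaleC: "c *\<^sub>C (d *\<^sub>C x) = (c * d) *\<^sub>C x"
    and scaleC_one: "1 *\<^sub>C x = x"
    and norm_scaleC: "norm (c *\<^sub>C x) = cmod c * norm x"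

text \<open>The inner product is linear in the first argument and conjugate linear in the second.\<close>

class complex_inner = complex_normed_vector +
  fixes cinner :: "'a \<Rightarrow> 'a \<Rightarrow> complex"
  assumes cinner_commute: "cinner x y = cnj (cinner y x)"
    and cinner_add_left: "cinner (x + y) z = cinner x z + cinner y z"
    and cinner_scaleC_left: "cinner (c *\<^sub>C x) y = c * cinner x y"
    and cinner_self: "cinner x x = complex_of_real ((norm x)\<^sup>2)"

class chilbert_space = complex_inner + complete_space

section \<open>Bounded operators\<close>

definition bounded_clinear :: "('a::complex_normed_vector \<Rightarrow> 'a) \<Rightarrow> bool" where
  "bounded_clinear A \<longleftrightarrow> bounded_linear A \<and> (\<forall>c x. A (c *\<^sub>C x) = c *\<^sub>C A x)"

definition invertible_op :: "('a::complex_normed_vector \<Rightarrow> 'a) \<Rightarrow> bool" where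
  "invertible_op A \<longleftrightarrow> (\<exists>B. bounded_clinear B \<and> A \<circ> B = id \<and> B \<circ> A = id)"

definition cadjoint :: "('a::chilbert_space \<Rightarrow> 'a) \<Rightarrow> 'a \<Rightarrow> 'a" where
  "cadjoint A = (THE B. bounded_clinear B \<and> (\<forall>x y. cinner (A x) y = cinner x (B y)))"

definition normal_op :: "('a::chilbert_space \<Rightarrow> 'a) \<Rightarrow> bool" where
  "normal_op A \<longleftrightarrow> A \<circ> cadjoint A = cadjoint A \<circ> A"

definition op_spectrum :: "('a::complex_normed_vector \<Rightarrow> 'a) \<Rightarrow> complex set" where
  "op_spectrum A = {z. \<not> invertible_op (\<lambda>x. A x - z *\<^sub>C x)}"

section \<open>Spectral measures\<close>

definition orthogonal_projection :: "('a::complex_inner \<Rightarrow> 'a) \<Rightarrow> bool" where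
  "orthogonal_projection P \<longleftrightarrow>
     bounded_clinear P \<and> P \<circ> P = P \<and> (\<forall>x y. cinner (P x) y = cinner x (P y))"

text \<open>Countable additivity is in the strong operator topology. Only the \<sigma>-algebra of
  the measure space \<open>M\<close> is relevant here.\<close>

definition projection_valued_measure ::
    "'b measure \<Rightarrow> ('b set \<Rightarrow> 'a::complex_inner \<Rightarrow> 'a) \<Rightarrow> bool" where
  "projection_valued_measure M E \<longleftrightarrow>
     (\<forall>S\<in>sets M. orthogonal_projection (E S)) \<and>
     E {} = (\<lambda>x. 0) \<and> E (space M) = id \<and>
     (\<forall>S\<in>sets M. \<forall>T\<in>sets M. E (S \<inter> T) = E S \<circ> E T) \<and>
     (\<forall>F :: nat \<Rightarrow> 'b set. range F \<subseteq> sets M \<longrightarrow> disjoint_family F \<longrightarrow>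
        (\<forall>x. (\<lambda>n. E (F n) x) sums E (\<Union>n. F n) x))"

text \<open>The scalar measure \<open>S \<mapsto> \<langle>E(S)x, x\<rangle>\<close>.\<close>

definition scalar_measure ::
    "'b measure \<Rightarrow> ('b set \<Rightarrow> 'a::complex_inner \<Rightarrow> 'a) \<Rightarrow> 'a \<Rightarrow> 'b measure" where
  "scalar_measure M E x = measure_of (space M) (sets M) (\<lambda>S. ennreal (Re (cinner (E S x) x)))"

text \<open>\<open>B = \<integral> f dE\<close> as a bounded operator, in the weak sense
  \<open>\<langle>Bx, x\<rangle> = \<integral> f d\<langle>E(\<cdot>)x, x\<rangle>\<close> for all \<open>x\<close>. Since the space is complex, polarization
  shows that this determines \<open>B\<close>.\<close>

definition has_spectral_integral ::
    "'b measure \<Rightarrow> ('b set \<Rightarrow> 'a::complex_inner \<Rightarrow> 'a) \<Rightarrow> ('b \<Rightarrow> complex) \<Rightarrow> ('a \<Rightarrow> 'a) \<Rightarrow> bool" where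
  "has_spectral_integral M E f B \<longleftrightarrow>
     bounded_clinear B \<and>
     (\<forall>x. integrable (scalar_measure M E x) f \<and>
          cinner (B x) x = (LINT z|scalar_measure M E x. f z))"

definition spectral_integral ::
    "'b measure \<Rightarrow> ('b set \<Rightarrow> 'a::complex_inner \<Rightarrow> 'a) \<Rightarrow> ('b \<Rightarrow> complex) \<Rightarrow> 'a \<Rightarrow> 'a" where
  "spectral_integral M E f = (THE B. has_spectral_integral M E f B)"

abbreviation borel_spectrum :: "('a::complex_normed_vector \<Rightarrow> 'a) \<Rightarrow> complex measure" where
  "borel_spectrum A \<equiv> restrict_space borel (op_spectrum A)"

text \<open>\<open>E\<close> is the spectral measure of \<open>A\<close>: a projection-valued measure on the Borel subsets of
  the spectrum with \<open>A = \<integral> z dE(z)\<close>. By the spectral theorem every bounded normal operator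
  has exactly one.\<close>

definition spectral_measure_of ::
    "('a::chilbert_space \<Rightarrow> 'a) \<Rightarrow> (complex set \<Rightarrow> 'a \<Rightarrow> 'a) \<Rightarrow> bool" where
  "spectral_measure_of A E \<longleftrightarrow>
     projection_valued_measure (borel_spectrum A) E \<and>
     has_spectral_integral (borel_spectrum A) E (\<lambda>z. z) A"

section \<open>Real powers of an operator\<close>

text \<open>The branch of the argument with values in \<open>[-\<pi>, \<pi>)\<close>; the library's \<^const>\<open>Arg\<close> takes
  values in \<open>(-\<pi>, \<pi>]\<close>, so that the two differ exactly on the negative real axis.\<close>

definition arg_low :: "complex \<Rightarrow> real" where
  "arg_low z = (if Arg z = pi then - pi else Arg z)"

definition branch_power :: "complex \<Rightarrow> real \<Rightarrow> complex" where
  "branch_power z t =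
     exp (complex_of_real t * (complex_of_real (ln (cmod z)) + \<i> * complex_of_real (arg_low z)))"

text \<open>The operator \<open>A\<^sup>t\<close>, for \<open>E\<close> the spectral measure of \<open>A\<close>.\<close>

definition op_power ::
    "('a::chilbert_space \<Rightarrow> 'a) \<Rightarrow> (complex set \<Rightarrow> 'a \<Rightarrow> 'a) \<Rightarrow> real \<Rightarrow> 'a \<Rightarrow> 'a" where
  "op_power A E t = spectral_integral (borel_spectrum A) E (\<lambda>z. branch_power z t)"

section \<open>Bessel systems\<close>

text \<open>A system of vectors is a family \<open>g\<close> indexed by a set \<open>I\<close>, so repetitions are allowed; a set
  \<open>G\<close> of vectors is the case \<open>g = id\<close>, \<open>I = G\<close>. Sums and integrals are taken in
  \<open>[0, \<infinity>]\<close>, so divergence is not mistaken for the value \<open>0\<close>.\<close>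

definition bessel_system :: "('i \<Rightarrow> 'a::complex_inner) \<Rightarrow> 'i set \<Rightarrow> bool" where
  "bessel_system g I \<longleftrightarrow>
     (\<exists>C>0. \<forall>f. (\<Sum>\<^sub>\<infinity>i\<in>I. ennreal ((cmod (cinner f (g i)))\<^sup>2)) \<le> ennreal (C * (norm f)\<^sup>2))"

text \<open>The same for a family \<open>h i t\<close> with \<open>i \<in> I\<close> and \<open>t \<in> [0, L]\<close>.\<close>

definition semicontinuous_bessel_system ::
    "('i \<Rightarrow> real \<Rightarrow> 'a::complex_inner) \<Rightarrow> 'i set \<Rightarrow> real \<Rightarrow> bool" where
  "semicontinuous_bessel_system h I L \<longleftrightarrow>
     (\<exists>C>0. \<forall>f. (\<Sum>\<^sub>\<infinity>i\<in>I. \<integral>\<^sup>+t\<in>{0..L}. ennreal ((cmod (cinner f (h i t)))\<^sup>2) \<partial>lborel)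
                 \<le> ennreal (C * (norm f)\<^sup>2))"

end

theory Submission
  imports Defs "HOL-Complex_Analysis.Cauchy_Integral_Theorem"
begin

text \<open>On the spectrum, which lies in an annulus \<open>r \<le> |z| \<le> R\<close> with \<open>r > 0\<close>, the function
  \<open>z\<^sup>t\<close> is Lipschitz in \<open>t \<in> [0, L]\<close> uniformly in \<open>z\<close>; hence so are \<open>A\<^sup>t\<close> and its adjoint
  \<open>S(t) = \<integral> cnj (z\<^sup>t) dE(z)\<close> in the operator norm, and \<open>S(0)\<close> is the identity. If \<open>\<G>\<close> is Bessel,
  one integrates \<open>\<Sum> |\<langle>f, A\<^sup>t g\<rangle>|\<^sup>2 = \<Sum> |\<langle>S(t) f, g\<rangle>|\<^sup>2 \<le> C \<parallel>S(t) f\<parallel>\<^sup>2\<close>. Conversely, let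
  \<open>k\<close> be the best Bessel constant of a finite subsystem. For small \<open>t\<close>, writing
  \<open>f = S(t) f + (f - S(t) f)\<close> gives
  \<open>\<Sum> |\<langle>f, g\<rangle>|\<^sup>2 \<le> 2 \<Sum> |\<langle>f, A\<^sup>t g\<rangle>|\<^sup>2 + (k / 2) \<parallel>f\<parallel>\<^sup>2\<close>. Integrating over \<open>t \<in> [0, \<delta>]\<close> and
  absorbing the last term bounds \<open>k\<close> independently of the finite subsystem.\<close>

section \<open>Polarization, and operator bounds from the quadratic form\<close>

section \<open>Polarization\<close>

lemma scaleC_neg_one: "(-1) *\<^sub>C x = - (x :: 'a::complex_normed_vector)"
  using scaleR_scaleC[of "-1" x] by simp

lemma scaleC_minus_left: "(- c) *\<^sub>C x = - (c *\<^sub>C (x :: 'a::complex_normed_vector))"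
  by (metis scaleC_neg_one scaleC_scaleC mult_minus1)

lemma scaleC_zero_right [simp]: "c *\<^sub>C (0 :: 'a::complex_normed_vector) = 0"
  using norm_scaleC[of c "0::'a"] by simp

lemma scaleC_diff_right:
  fixes x y :: "'a::complex_normed_vector"
  shows "c *\<^sub>C (x - y) = c *\<^sub>C x - c *\<^sub>C y"
  using scaleC_add_right[of c "x - y" y] by (simp add: algebra_simps)

lemma bounded_linear_scaleC: "bounded_linear (\<lambda>x :: 'a::complex_normed_vector. c *\<^sub>C x)"
proof (rule bounded_linear_intro[where K="cmod c"])
  show "c *\<^sub>C (r *\<^sub>R x) = r *\<^sub>R (c *\<^sub>C x)" for r and x :: 'a
    by (simp add: scaleR_scaleC scaleC_scaleC mult.commute)
qed (simp_all add: scaleC_add_right norm_scaleC)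

lemma cinner_add_right: "cinner x (y + z) = cinner x y + cinner x (z :: 'a::complex_inner)"
  by (metis cinner_add_left cinner_commute complex_cnj_add)

lemma cinner_scaleC_right: "cinner x (c *\<^sub>C y) = cnj c * cinner x (y :: 'a::complex_inner)"
  by (metis cinner_commute cinner_scaleC_left complex_cnj_mult)

lemma cinner_minus_left: "cinner (- x) y = - cinner x (y :: 'a::complex_inner)"
  using cinner_scaleC_left[of "-1" x y] by (simp add: scaleC_neg_one)

lemma cinner_minus_right: "cinner x (- y) = - cinner x (y :: 'a::complex_inner)"
  using cinner_scaleC_right[of x "-1" y] by (simp add: scaleC_neg_one)

lemma cinner_diff_left: "cinner (x - y) z = cinner x z - cinner y (z :: 'a::complex_inner)"
  using cinner_add_left[of x "- y" z] by (simp add: cinner_minus_left)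

lemma cinner_diff_right: "cinner x (y - z) = cinner x y - cinner x (z :: 'a::complex_inner)"
  using cinner_add_right[of x y "- z"] by (simp add: cinner_minus_right)

lemma cinner_zero_left [simp]: "cinner 0 (x :: 'a::complex_inner) = 0"
  using cinner_diff_left[of 0 0 x] by simp

lemmas cinner_simps = cinner_add_left cinner_add_right cinner_diff_left cinner_diff_right
  cinner_scaleC_left cinner_scaleC_right cinner_minus_left cinner_minus_right

text \<open>Expanding the four values of the quadratic form cancels everything except the terms in
  \<open>cinner (B x) y\<close>. Subtraction is written as adding a scalar multiple, so that the two
  hypotheses on \<open>B\<close> alone expand every term.\<close>

lemma cinner_polarization:
  fixes B :: "'a::complex_inner \<Rightarrow> 'a"
  assumes "\<And>x y. B (x + y) = B x + B y" and "\<And>c x. B (c *\<^sub>C x) = c *\<^sub>C B x"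
  shows "4 * cinner (B x) y = cinner (B (x + y)) (x + y) - cinner (B (x + (-1) *\<^sub>C y)) (x + (-1) *\<^sub>C y)
     + \<i> * cinner (B (x + \<i> *\<^sub>C y)) (x + \<i> *\<^sub>C y)
     - \<i> * cinner (B (x + (-\<i>) *\<^sub>C y)) (x + (-\<i>) *\<^sub>C y)"
  unfolding assms by (simp add: cinner_simps) (simp add: algebra_simps)

lemma parallelogram_law:
  fixes x y :: "'a::complex_inner"
  shows "(norm (x + y))\<^sup>2 + (norm (x - y))\<^sup>2 = 2 * (norm x)\<^sup>2 + 2 * (norm y)\<^sup>2"
proof -
  have "complex_of_real ((norm (x + y))\<^sup>2 + (norm (x - y))\<^sup>2) =
      complex_of_real (2 * (norm x)\<^sup>2 + 2 * (norm y)\<^sup>2)"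
    unfolding of_real_add of_real_mult cinner_self[symmetric]
    by (simp add: cinner_simps)
  then show ?thesis
    by (simp only: of_real_eq_iff)
qed

text \<open>Polarization bounds \<open>4 * cinner (B u) v\<close> by four values of the quadratic
  form, and the parallelogram law, applied to the pairs u, v and u, iv, collapses these to a
  multiple of the sum of the squared norms. For unit vectors that sum is 2, which is the factor in
  the bound; the general case follows by normalising.\<close>

lemma cmod_cinner_le_numerical_radius:
  fixes B :: "'a::complex_inner \<Rightarrow> 'a"
  assumes add: "\<And>x y. B (x + y) = B x + B y" and scale: "\<And>c x. B (c *\<^sub>C x) = c *\<^sub>C B x"
    and M: "\<And>x. cmod (cinner (B x) x) \<le> M * (norm x)\<^sup>2"
  shows "cmod (cinner (B x) y) \<le> 2 * M * norm x * norm y"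
proof -
  have sq: "cmod (cinner (B u) v) \<le> M * ((norm u)\<^sup>2 + (norm v)\<^sup>2)" for u v
  proof -
    have "cmod (4 * cinner (B u) v) \<le>
        cmod (cinner (B (u + v)) (u + v)) + cmod (cinner (B (u + (-1) *\<^sub>C v)) (u + (-1) *\<^sub>C v))
      + cmod (cinner (B (u + \<i> *\<^sub>C v)) (u + \<i> *\<^sub>C v))
      + cmod (cinner (B (u + (-\<i>) *\<^sub>C v)) (u + (-\<i>) *\<^sub>C v))"
      unfolding cinner_polarization[of B, OF add scale]
      by (intro order_trans[OF norm_triangle_ineq4] add_mono order_trans[OF norm_triangle_ineq])
        (simp_all add: norm_mult)
    also have "\<dots> \<le> M * (norm (u + v))\<^sup>2 + M * (norm (u + (-1) *\<^sub>C v))\<^sup>2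
        + M * (norm (u + \<i> *\<^sub>C v))\<^sup>2 + M * (norm (u + (-\<i>) *\<^sub>C v))\<^sup>2"
      by (intro add_mono M)
    also have "\<dots> = M * ((norm (u + v))\<^sup>2 + (norm (u - v))\<^sup>2)
        + M * ((norm (u + \<i> *\<^sub>C v))\<^sup>2 + (norm (u - \<i> *\<^sub>C v))\<^sup>2)"
      by (simp add: scaleC_minus_left scaleC_one algebra_simps)
    also have "\<dots> = 4 * (M * ((norm u)\<^sup>2 + (norm v)\<^sup>2))"
      unfolding parallelogram_law by (simp add: norm_scaleC algebra_simps)
    finally show ?thesis by (simp add: norm_mult)
  qed
  show ?thesis
  proof (cases "x = 0 \<or> y = 0")
    case True
    have "B 0 = 0" using scale[of 0 0] norm_scaleC[of 0 "B 0"] by simp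
    moreover have "cinner (B x) 0 = 0" using cinner_zero_left cinner_commute by (metis complex_cnj_zero)
    ultimately show ?thesis using True by auto
  next
    case False
    define a where "a = complex_of_real (1 / norm x)"
    define b where "b = complex_of_real (1 / norm y)"
    have "cmod (cinner (B (a *\<^sub>C x)) (b *\<^sub>C y)) \<le> M * ((norm (a *\<^sub>C x))\<^sup>2 + (norm (b *\<^sub>C y))\<^sup>2)"
      by (rule sq)
    also have "\<dots> = 2 * M"
      using False by (simp add: norm_scaleC a_def b_def norm_divide)
    finally have "cmod (cinner (B x) y) / (norm x * norm y) \<le> 2 * M"
      by (simp add: scale cinner_simps a_def b_def norm_mult norm_divide mult.commute)
    then show ?thesis using False by (simp add: field_simps)
  qed
qed

text \<open>The Cauchy-Schwarz inequality up to a factor 2, from the identity operator and M = 1.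
  Where it is applied, the constant only has to be finite.\<close>

lemma cmod_cinner_le: "cmod (cinner x y) \<le> 2 * norm x * norm (y :: 'a::complex_inner)"
  using cmod_cinner_le_numerical_radius[of "\<lambda>x. x" 1 x y] by (simp add: cinner_self norm_power)

text \<open>Take \<open>y = B x\<close> in the preceding bound and cancel one factor
  \<open>norm (B x)\<close>.\<close>

lemma norm_le_numerical_radius:
  fixes B :: "'a::complex_inner \<Rightarrow> 'a"
  assumes "\<And>x y. B (x + y) = B x + B y" and "\<And>c x. B (c *\<^sub>C x) = c *\<^sub>C B x"
    and "\<And>x. cmod (cinner (B x) x) \<le> M * (norm x)\<^sup>2"
  shows "norm (B x) \<le> 2 * M * norm x"
proof (cases "B x = 0")
  case True
  \<comment> \<open>The sign of M is not assumed; the hypothesis forces it to be nonnegative as soon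
    as x is nonzero.\<close>
  have "0 \<le> M * norm x * norm x"
    using order_trans[OF norm_ge_zero assms(3)[of x]] by (simp add: power2_eq_square mult.assoc)
  then show ?thesis
    using True by (cases "norm x = 0") (auto simp: zero_le_mult_iff)
next
  case False
  have "norm (B x) * norm (B x) = cmod (cinner (B x) (B x))"
    by (simp add: cinner_self norm_power power2_eq_square norm_mult)
  also have "\<dots> \<le> 2 * M * norm x * norm (B x)"
    by (rule cmod_cinner_le_numerical_radius[OF assms])
  finally show ?thesis using False by simp
qed

lemma bounded_linear_cinner_left: "bounded_linear (\<lambda>x. cinner x (y :: 'a::complex_inner))"
proof (rule bounded_linear_intro[where K="2 * norm y"])
  show "norm (cinner x y) \<le> norm x * (2 * norm y)" for x
    using cmod_cinner_le[of x y] by (simp add: mult_ac)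
qed (simp_all add: cinner_simps scaleR_scaleC scaleR_conv_of_real)

section \<open>Bounded operators, and an annulus containing the spectrum\<close>

section \<open>Bounded operators and the spectrum\<close>

lemma bounded_clinear_add: "bounded_clinear B \<Longrightarrow> B (x + y) = B x + B y"
  by (simp add: bounded_clinear_def bounded_linear.linear linear_add)

lemma bounded_clinear_scaleC: "bounded_clinear B \<Longrightarrow> B (c *\<^sub>C x) = c *\<^sub>C B x"
  by (simp add: bounded_clinear_def)

lemma bounded_clinear_diff: "bounded_clinear B \<Longrightarrow> B (x - y) = B x - B y"
  by (simp add: bounded_clinear_def bounded_linear.linear linear_diff)

lemma bounded_clinear_zero: "bounded_clinear (\<lambda>x. 0)"
  by (simp add: bounded_clinear_def)

lemma bounded_clinear_id: "bounded_clinear id"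
  by (simp add: bounded_clinear_def id_def)

lemma bounded_clinear_compose:
  "bounded_clinear B \<Longrightarrow> bounded_clinear C \<Longrightarrow> bounded_clinear (\<lambda>x. B (C x))"
  by (simp add: bounded_clinear_def bounded_linear_compose)

lemma bounded_clinear_plus:
  "bounded_clinear B \<Longrightarrow> bounded_clinear C \<Longrightarrow> bounded_clinear (\<lambda>x. B x + C x)"
  by (simp add: bounded_clinear_def bounded_linear_add scaleC_add_right)

lemma bounded_clinear_minus:
  "bounded_clinear B \<Longrightarrow> bounded_clinear C \<Longrightarrow> bounded_clinear (\<lambda>x. B x - C x)"
  by (simp add: bounded_clinear_def bounded_linear_sub scaleC_diff_right)

lemma bounded_clinear_scale:
  "bounded_clinear B \<Longrightarrow> bounded_clinear (\<lambda>x. c *\<^sub>C B x)"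
  using bounded_linear_compose[OF bounded_linear_scaleC]
  by (auto simp: bounded_clinear_def scaleC_scaleC mult.commute)

lemma bounded_clinear_intro:
  assumes "\<And>x y. B (x + y) = B x + B y" and "\<And>c x. B (c *\<^sub>C x) = c *\<^sub>C B x"
    and "\<And>x. norm (B x) \<le> K * norm x"
  shows "bounded_clinear B"
  unfolding bounded_clinear_def
proof (intro conjI allI)
  show "bounded_linear B"
    by (rule bounded_linear_intro[where K=K]) (simp_all add: assms scaleR_scaleC mult.commute)
qed (rule assms)

lemma bounded_clinear_bound:
  assumes "bounded_clinear B"
  obtains K where "K > 0" "\<And>x. norm (B x) \<le> K * norm x"
  using bounded_linear.pos_bounded[of B] assms
  by (auto simp: bounded_clinear_def mult.commute)

text \<open>The difference has numerical radius 0, hence norm 0. This makes an operator given weakly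
  by its quadratic form unique.\<close>

lemma bounded_clinear_eqI:
  fixes B C :: "'a::complex_inner \<Rightarrow> 'a"
  assumes B: "bounded_clinear B" and C: "bounded_clinear C"
    and eq: "\<And>x. cinner (B x) x = cinner (C x) x"
  shows "B = C"
proof
  fix x
  have D: "bounded_clinear (\<lambda>x. B x - C x)"
    by (rule bounded_clinear_minus[OF B C])
  have "norm (B x - C x) \<le> 2 * 0 * norm x"
    using norm_le_numerical_radius[of "\<lambda>x. B x - C x" 0 x]
      bounded_clinear_add[OF D] bounded_clinear_scaleC[OF D] by (simp add: cinner_simps eq)
  then show "B x = C x" by simp
qed

text \<open>Polarize \<open>C\<close>, replace each value by the conjugate of that of
  \<open>B\<close>, and recombine. An adjoint pair is thus recognised from the diagonal values
  alone.\<close>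

lemma adjoint_from_quadratic_form:
  fixes B C :: "'a::complex_inner \<Rightarrow> 'a"
  assumes B: "bounded_clinear B" and C: "bounded_clinear C"
    and q: "\<And>x. cinner (C x) x = cnj (cinner (B x) x)"
  shows "cinner x (B y) = cinner (C x) y"
proof -
  have "4 * cinner (C x) y = 4 * cnj (cinner (B y) x)"
  proof -
    have "4 * cinner (C x) y = cinner (C (x + y)) (x + y)
        - cinner (C (x + (-1) *\<^sub>C y)) (x + (-1) *\<^sub>C y)
        + \<i> * cinner (C (x + \<i> *\<^sub>C y)) (x + \<i> *\<^sub>C y)
        - \<i> * cinner (C (x + (-\<i>) *\<^sub>C y)) (x + (-\<i>) *\<^sub>C y)"
      by (rule cinner_polarization[OF bounded_clinear_add[OF C] bounded_clinear_scaleC[OF C]])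
    also have "\<dots> = 4 * cnj (cinner (B y) x)"
      unfolding q bounded_clinear_add[OF B] bounded_clinear_scaleC[OF B]
      by (simp add: cinner_simps) (simp add: algebra_simps)
    finally show ?thesis .
  qed
  then show ?thesis using cinner_commute[of x "B y"] by simp
qed

text \<open>Linearity of the inverse follows from injectivity of \<open>B\<close>, and its
  boundedness, with constant 1/c, from the lower bound; no open mapping argument is
  involved.\<close>

lemma invertible_op_bij:
  assumes B: "bounded_clinear B" and inv: "\<And>y. \<exists>!x. B x = y"
    and low: "c > 0" "\<And>x. c * norm x \<le> norm (B x)"
  shows "invertible_op B"
proof -
  define D where "D y = (THE x. B x = y)" for y
  have BD: "B (D y) = y" for y
    unfolding D_def by (rule theI') (rule inv)
  have inj: "x = y" if "B x = B y" for x y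
    using inv[of "B x"] that by metis
  have DB: "D (B x) = x" for x
    using BD inj by blast
  have "bounded_clinear D"
  proof (rule bounded_clinear_intro[where K="1 / c"])
    show "D (x + y) = D x + D y" for x y
      by (rule inj) (simp add: BD bounded_clinear_add[OF B])
    show "D (a *\<^sub>C x) = a *\<^sub>C D x" for a x
      by (rule inj) (simp add: BD bounded_clinear_scaleC[OF B])
    show "norm (D x) \<le> 1 / c * norm x" for x
      using low(2)[of "D x"] low(1) by (simp add: BD field_simps)
  qed
  moreover have "B \<circ> D = id" "D \<circ> B = id"
    by (auto simp: BD DB)
  ultimately show ?thesis unfolding invertible_op_def by blast
qed

text \<open>Solving x - T x = y means finding a fixed point of the contraction x \<mapsto> y + T x,
  which exists uniquely by completeness. The triangle inequality gives the lower bound 1 -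
  q.\<close>

lemma invertible_op_id_minus_contraction:
  fixes T :: "'a::chilbert_space \<Rightarrow> 'a"
  assumes T: "bounded_clinear T" and q: "0 \<le> q" "q < 1" and le: "\<And>x. norm (T x) \<le> q * norm x"
  shows "invertible_op (\<lambda>x. x - T x)"
proof (rule invertible_op_bij[where c="1 - q"])
  show "bounded_clinear (\<lambda>x. x - T x)"
    using bounded_clinear_minus[OF bounded_clinear_id T] by simp
  show "1 - q > 0" using q by simp
  show "(1 - q) * norm x \<le> norm (x - T x)" for x
    using norm_triangle_ineq2[of x "T x"] le[of x] by (simp add: algebra_simps)
  show "\<exists>!x. x - T x = y" for y
  proof -
    have "\<exists>!x. y + T x = x"
      by (rule banach_fix_type[OF q])
        (simp add: dist_norm bounded_clinear_diff[OF T, symmetric] le)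
    moreover have "x - T x = y \<longleftrightarrow> y + T x = x" for x
      by (auto simp: algebra_simps)
    ultimately show ?thesis by simp
  qed
qed

lemma invertible_op_compose:
  assumes "invertible_op B" and "invertible_op C"
  shows "invertible_op (\<lambda>x. B (C x))"
proof -
  obtain B' C' where B': "bounded_clinear B'" "B \<circ> B' = id" "B' \<circ> B = id"
    and C': "bounded_clinear C'" "C \<circ> C' = id" "C' \<circ> C = id"
    using assms by (auto simp: invertible_op_def)
  show ?thesis
    unfolding invertible_op_def
  proof (intro exI[of _ "\<lambda>x. C' (B' x)"] conjI)
    show "bounded_clinear (\<lambda>x. C' (B' x))"
      by (rule bounded_clinear_compose[OF C'(1) B'(1)])
    show "(\<lambda>x. B (C x)) \<circ> (\<lambda>x. C' (B' x)) = id" "(\<lambda>x. C' (B' x)) \<circ> (\<lambda>x. B (C x)) = id"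
      using B' C' by (simp_all add: fun_eq_iff)
  qed
qed

lemma invertible_op_scaleC:
  assumes "c \<noteq> 0"
  shows "invertible_op (\<lambda>x :: 'a::complex_normed_vector. c *\<^sub>C x)"
  unfolding invertible_op_def
proof (intro exI[of _ "\<lambda>x. (1 / c) *\<^sub>C x"] conjI)
  show "bounded_clinear (\<lambda>x :: 'a. (1 / c) *\<^sub>C x)"
    using bounded_clinear_scale[OF bounded_clinear_id] by simp
qed (use assms in \<open>simp_all add: fun_eq_iff scaleC_scaleC scaleC_one\<close>)

text \<open>Factor A - z = -z (1 - A/z). If |z| exceeds K, then A/z is a strict contraction and both
  factors are invertible.\<close>

lemma spectrum_upper_bound:
  fixes A :: "'a::chilbert_space \<Rightarrow> 'a"
  assumes A: "bounded_clinear A" and K: "K > 0" "\<And>x. norm (A x) \<le> K * norm x"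
    and z: "z \<in> op_spectrum A"
  shows "cmod z \<le> K"
proof (rule ccontr)
  assume "\<not> cmod z \<le> K"
  then have zK: "K < cmod z" and z0: "z \<noteq> 0" using K(1) by auto
  have "invertible_op (\<lambda>x. x - (1 / z) *\<^sub>C A x)"
  proof (rule invertible_op_id_minus_contraction[where q="K / cmod z"])
    show "bounded_clinear (\<lambda>x. (1 / z) *\<^sub>C A x)" by (rule bounded_clinear_scale[OF A])
    show "norm ((1 / z) *\<^sub>C A x) \<le> K / cmod z * norm x" for x
      using K(2)[of x] by (simp add: norm_scaleC norm_divide divide_right_mono)
  qed (use zK K(1) in \<open>auto simp: divide_less_eq\<close>)
  then have "invertible_op (\<lambda>x. (- z) *\<^sub>C (x - (1 / z) *\<^sub>C A x))"
    by (rule invertible_op_compose[OF invertible_op_scaleC, rotated]) (use z0 in simp)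
  moreover have "(- z) *\<^sub>C (x - (1 / z) *\<^sub>C A x) = A x - z *\<^sub>C x" for x
    using z0 by (simp add: scaleC_diff_right scaleC_scaleC scaleC_minus_left scaleC_one)
  ultimately show False using z by (simp add: op_spectrum_def)
qed

text \<open>With B the inverse of A, factor A - z = A (1 - z B). If |z| is below 1/K, where K bounds
  B, then z B is a strict contraction.\<close>

lemma spectrum_lower_bound:
  fixes A :: "'a::chilbert_space \<Rightarrow> 'a"
  assumes A: "bounded_clinear A" "invertible_op A"
  obtains r where "r > 0" "\<And>z. z \<in> op_spectrum A \<Longrightarrow> r \<le> cmod z"
proof -
  obtain B where B: "bounded_clinear B" "A \<circ> B = id" "B \<circ> A = id"
    using A(2) by (auto simp: invertible_op_def)
  obtain K where K: "K > 0" "\<And>x. norm (B x) \<le> K * norm x"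
    using bounded_clinear_bound[OF B(1)] by blast
  have "1 / K \<le> cmod z" if z: "z \<in> op_spectrum A" for z
  proof (rule ccontr)
    assume "\<not> 1 / K \<le> cmod z"
    then have zK: "cmod z * K < 1" using K(1) by (simp add: field_simps)
    have "invertible_op (\<lambda>x. x - z *\<^sub>C B x)"
    proof (rule invertible_op_id_minus_contraction[where q="cmod z * K"])
      show "bounded_clinear (\<lambda>x. z *\<^sub>C B x)" by (rule bounded_clinear_scale[OF B(1)])
      show "norm (z *\<^sub>C B x) \<le> cmod z * K * norm x" for x
        using K(2)[of x] by (simp add: norm_scaleC mult.assoc mult_left_mono)
    qed (use zK K(1) in auto)
    then have "invertible_op (\<lambda>x. A (x - z *\<^sub>C B x))"
      by (rule invertible_op_compose[OF A(2)])
    moreover have "A (x - z *\<^sub>C B x) = A x - z *\<^sub>C x" for x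
      using B(2) by (simp add: bounded_clinear_diff[OF A(1)] bounded_clinear_scaleC[OF A(1)] fun_eq_iff)
    ultimately show False using z by (simp add: op_spectrum_def)
  qed
  then show thesis using that[of "1 / K"] K(1) by simp
qed

section \<open>Existence, uniqueness and norm bounds of spectral integrals of bounded Borel
  functions\<close>

section \<open>Integration against a projection-valued measure\<close>

lemma orthogonal_projection_cinner_self:
  assumes "orthogonal_projection P"
  shows "cinner (P x) x = complex_of_real ((norm (P x))\<^sup>2)"
proof -
  have "cinner (P x) x = cinner (P (P x)) x"
    using assms by (auto simp: orthogonal_projection_def fun_eq_iff)
  also have "\<dots> = cinner (P x) (P x)"
    using assms by (auto simp: orthogonal_projection_def)
  finally show ?thesis by (simp add: cinner_self)
qed

lemma space_scalar_measure [simp]: "space (scalar_measure M E x) = space M"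
  and sets_scalar_measure [simp, measurable_cong]: "sets (scalar_measure M E x) = sets M"
  by (simp_all add: scalar_measure_def sets.space_closed sets.sigma_sets_eq space_measure_of_conv)

text \<open>\<open>measure_of\<close> yields the intended values only for a countably additive set
  function. Additivity comes from strong convergence, passed through the continuous functional
  \<open>cinner _ x\<close>; nonnegativity holds because the values are squared norms of
  projections.\<close>

lemma emeasure_scalar_measure:
  assumes pvm: "projection_valued_measure M E" and S: "S \<in> sets M"
  shows "emeasure (scalar_measure M E x) S = ennreal ((norm (E S x))\<^sup>2)"
proof -
  define \<mu> where "\<mu> T = ennreal (Re (cinner (E T x) x))" for T
  have \<mu>: "Re (cinner (E T x) x) = (norm (E T x))\<^sup>2" if "T \<in> sets M" for T
    using pvm that orthogonal_projection_cinner_self[of "E T" x]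
    by (simp add: projection_valued_measure_def)
  have "emeasure (measure_of (space M) (sets M) \<mu>) S = \<mu> S"
  proof (rule emeasure_measure_of_sigma[OF sets.sigma_algebra_axioms _ _ S])
    show "positive (sets M) \<mu>"
      using pvm by (simp add: positive_def \<mu>_def projection_valued_measure_def)
    show "countably_additive (sets M) \<mu>"
      unfolding countably_additive_def
    proof (intro allI impI)
      fix F :: "nat \<Rightarrow> 'a set"
      assume F: "range F \<subseteq> sets M" "disjoint_family F" and U: "(\<Union>n. F n) \<in> sets M"
      have "(\<lambda>n. E (F n) x) sums E (\<Union>n. F n) x"
        using pvm F by (simp add: projection_valued_measure_def)
      then have "(\<lambda>n. Re (cinner (E (F n) x) x)) sums Re (cinner (E (\<Union>n. F n) x) x)"
        by (intro sums_Re bounded_linear.sums[OF bounded_linear_cinner_left])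
      moreover have "0 \<le> Re (cinner (E (F n) x) x)" for n
        using F(1) by (subst \<mu>) auto
      ultimately show "(\<Sum>n. \<mu> (F n)) = \<mu> (\<Union>n. F n)"
        unfolding \<mu>_def by (intro suminf_ennreal_eq)
    qed
  qed
  then show ?thesis
    unfolding scalar_measure_def \<mu>_def[abs_def] \<mu>[OF S] .
qed

lemma measure_scalar_measure:
  "projection_valued_measure M E \<Longrightarrow> S \<in> sets M \<Longrightarrow>
    measure (scalar_measure M E x) S = (norm (E S x))\<^sup>2"
  by (simp add: measure_def emeasure_scalar_measure)

lemma finite_measure_scalar_measure:
  "projection_valued_measure M E \<Longrightarrow> finite_measure (scalar_measure M E x)"
  by (intro finite_measureI) (simp add: emeasure_scalar_measure)

lemma measure_space_scalar_measure:
  "projection_valued_measure M E \<Longrightarrow> measure (scalar_measure M E x) (space M) = (norm x)\<^sup>2"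
  by (simp add: measure_scalar_measure) (simp add: projection_valued_measure_def)

lemma has_spectral_integral_unique:
  assumes "has_spectral_integral M E f B" and "has_spectral_integral M E f C"
  shows "B = C"
  using assms by (intro bounded_clinear_eqI) (auto simp: has_spectral_integral_def)

lemma spectral_integral_eqI:
  "has_spectral_integral M E f B \<Longrightarrow> spectral_integral M E f = B"
  unfolding spectral_integral_def by (blast intro: the_equality has_spectral_integral_unique)

lemma has_spectral_integral_cong:
  assumes "\<And>z. z \<in> space M \<Longrightarrow> f z = h z"
  shows "has_spectral_integral M E f B \<longleftrightarrow> has_spectral_integral M E h B"
proof -
  have "integrable (scalar_measure M E x) f = integrable (scalar_measure M E x) h"
    "(LINT z|scalar_measure M E x. f z) = (LINT z|scalar_measure M E x. h z)" for x
    using assms by (auto intro!: Bochner_Integration.integrable_cong Bochner_Integration.integral_cong)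
  then show ?thesis by (simp add: has_spectral_integral_def)
qed

lemma has_spectral_integral_indicator:
  assumes pvm: "projection_valued_measure M E" and S: "S \<in> sets M"
  shows "has_spectral_integral M E (indicator S) (E S)"
proof -
  have P: "orthogonal_projection (E S)"
    using pvm S by (simp add: projection_valued_measure_def)
  interpret finite_measure "scalar_measure M E x" for x
    by (rule finite_measure_scalar_measure[OF pvm])
  have "has_bochner_integral (scalar_measure M E x) (indicator S) (cinner (E S x) x)" for x
  proof -
    have "has_bochner_integral (scalar_measure M E x) (\<lambda>z. indicator S z *\<^sub>R (1::complex))
        (measure (scalar_measure M E x) S *\<^sub>R 1)"
      using S by (intro has_bochner_integral_indicator) (simp_all add: emeasure_scalar_measure[OF pvm])
    moreover have "(\<lambda>z. indicator S z *\<^sub>R (1::complex)) = indicator S"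
      by (auto simp: indicator_def)
    ultimately show ?thesis
      by (simp add: measure_scalar_measure[OF pvm S] orthogonal_projection_cinner_self[OF P]
          scaleR_conv_of_real)
  qed
  then show ?thesis
    using P unfolding has_spectral_integral_def orthogonal_projection_def
    by (auto simp: has_bochner_integral_iff)
qed

lemma has_spectral_integral_zero: "has_spectral_integral M E (\<lambda>z. 0) (\<lambda>x. 0)"
  by (simp add: has_spectral_integral_def bounded_clinear_zero)

lemma has_spectral_integral_add:
  "has_spectral_integral M E f B \<Longrightarrow> has_spectral_integral M E h C \<Longrightarrow>
    has_spectral_integral M E (\<lambda>z. f z + h z) (\<lambda>x. B x + C x)"
  by (simp add: has_spectral_integral_def bounded_clinear_plus cinner_simps)

lemma has_spectral_integral_diff:
  "has_spectral_integral M E f B \<Longrightarrow> has_spectral_integral M E h C \<Longrightarrow>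
    has_spectral_integral M E (\<lambda>z. f z - h z) (\<lambda>x. B x - C x)"
  by (simp add: has_spectral_integral_def bounded_clinear_minus cinner_simps)

lemma has_spectral_integral_scale:
  "has_spectral_integral M E f B \<Longrightarrow> has_spectral_integral M E (\<lambda>z. c * f z) (\<lambda>x. c *\<^sub>C B x)"
  by (simp add: has_spectral_integral_def bounded_clinear_scale cinner_simps)

lemma has_spectral_integral_sum:
  assumes "finite Y" and "\<And>y. y \<in> Y \<Longrightarrow> has_spectral_integral M E (f y) (B y)"
  shows "has_spectral_integral M E (\<lambda>z. \<Sum>y\<in>Y. f y z) (\<lambda>x. \<Sum>y\<in>Y. B y x)"
  using assms
  by (induction Y rule: finite_induct)
    (auto intro: has_spectral_integral_zero has_spectral_integral_add)

text \<open>A simple function is the linear combination of the indicators of its finitely many level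
  sets, so the integral is the same combination of projections.\<close>

lemma has_spectral_integral_simple_function:
  fixes f :: "'b \<Rightarrow> complex"
  assumes pvm: "projection_valued_measure M E" and f: "simple_function M f"
  shows "\<exists>B. has_spectral_integral M E f B"
proof -
  define S where "S y = f -` {y} \<inter> space M" for y
  have fin: "finite (f ` space M)" and S: "S y \<in> sets M" for y
    using f by (auto simp: S_def simple_functionD)
  have "has_spectral_integral M E (\<lambda>z. \<Sum>y\<in>f ` space M. y * indicator (S y) z)
      (\<lambda>x. \<Sum>y\<in>f ` space M. y *\<^sub>C E (S y) x)"
    by (intro has_spectral_integral_sum[OF fin] has_spectral_integral_scale
        has_spectral_integral_indicator[OF pvm S])
  moreover have "(\<Sum>y\<in>f ` space M. y * indicator (S y) z) = f z" if "z \<in> space M" for z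
  proof -
    have "(\<Sum>y\<in>f ` space M. y * indicator (S y) z) = (\<Sum>y\<in>f ` space M. if y = f z then y else 0)"
      using that by (intro sum.cong) (auto simp: S_def indicator_def)
    also have "\<dots> = f z" using that fin by simp
    finally show ?thesis .
  qed
  ultimately show ?thesis
    using has_spectral_integral_cong by (metis (mono_tags, lifting))
qed

text \<open>The scalar measure of x has total mass \<open>(norm x)\<^sup>2\<close>, so c bounds the
  numerical radius; passing to the norm costs the factor 2.\<close>

lemma has_spectral_integral_norm_le:
  assumes pvm: "projection_valued_measure M E" and B: "has_spectral_integral M E f B"
    and c: "\<And>z. z \<in> space M \<Longrightarrow> cmod (f z) \<le> c"
  shows "norm (B x) \<le> 2 * c * norm x"
proof (rule norm_le_numerical_radius)
  have bc: "bounded_clinear B" using B by (simp add: has_spectral_integral_def)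
  show "B (x + y) = B x + B y" "B (a *\<^sub>C x) = a *\<^sub>C B x" for x y a
    using bounded_clinear_add[OF bc] bounded_clinear_scaleC[OF bc] by auto
  show "cmod (cinner (B x) x) \<le> c * (norm x)\<^sup>2" for x
  proof -
    interpret finite_measure "scalar_measure M E x"
      by (rule finite_measure_scalar_measure[OF pvm])
    have int: "integrable (scalar_measure M E x) f"
      using B by (simp add: has_spectral_integral_def)
    have "cmod (cinner (B x) x) = cmod (LINT z|scalar_measure M E x. f z)"
      using B by (simp add: has_spectral_integral_def)
    also have "\<dots> \<le> (LINT z|scalar_measure M E x. cmod (f z))"
      by (rule integral_norm_bound)
    also have "\<dots> \<le> (LINT z|scalar_measure M E x. c)"
      by (intro integral_mono integrable_norm int) (simp_all add: c)
    also have "\<dots> = c * (norm x)\<^sup>2"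
      by (simp add: measure_space_scalar_measure[OF pvm])
    finally show ?thesis .
  qed
qed

text \<open>The norm estimate, applied to differences, makes \<open>B n x\<close> a Cauchy sequence,
  and completeness supplies the limit operator. Its quadratic form is identified by dominated
  convergence in each scalar measure.\<close>

lemma has_spectral_integral_uniform_limit:
  fixes E :: "'b set \<Rightarrow> 'a::chilbert_space \<Rightarrow> 'a"
  assumes pvm: "projection_valued_measure M E"
    and B: "\<And>n. has_spectral_integral M E (f n) (B n)"
    and lim: "uniform_limit (space M) f h sequentially"
  shows "\<exists>C. has_spectral_integral M E h C"
proof -
  have diff: "norm (B m x - B n x) \<le> 2 * e * norm x"
    if "\<And>z. z \<in> space M \<Longrightarrow> cmod (f m z - f n z) \<le> e" for m n e x
    by (rule has_spectral_integral_norm_le[OF pvm has_spectral_integral_diff[OF B B] that])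
  have unif: "\<exists>N. \<forall>n\<ge>N. \<forall>m\<ge>N. \<forall>z\<in>space M. cmod (f m z - f n z) \<le> e" if "e > 0" for e
  proof -
    have "uniformly_Cauchy_on (space M) f"
      by (rule uniformly_convergent_Cauchy[OF uniformly_convergentI[OF lim]])
    then show ?thesis
      using that unfolding uniformly_Cauchy_on_def dist_norm by (meson less_imp_le)
  qed
  have "Cauchy (\<lambda>n. B n x)" for x
  proof (rule metric_CauchyI)
    fix e :: real assume e: "e > 0"
    \<comment> \<open>The added 1 keeps the denominator positive at x = 0 and makes
      \<open>2 * d * norm x\<close> strictly less than e.\<close>
    define d where "d = e / (2 * norm x + 1)"
    have d: "d > 0" unfolding d_def using e by (intro divide_pos_pos add_nonneg_pos) auto
    have "2 * d * norm x = e * (2 * norm x / (2 * norm x + 1))" by (simp add: d_def)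
    also have "\<dots> < e"
      using e norm_ge_zero[of x] by (simp add: divide_less_eq del: norm_ge_zero)
    finally have lt: "2 * d * norm x < e" .
    from unif[OF d] obtain N where "\<And>m n z. n \<ge> N \<Longrightarrow> m \<ge> N \<Longrightarrow> z \<in> space M \<Longrightarrow> cmod (f m z - f n z) \<le> d"
      by blast
    then have "dist (B m x) (B n x) < e" if "m \<ge> N" "n \<ge> N" for m n
      using diff[of m n d x] lt that by (force simp: dist_norm)
    then show "\<exists>N. \<forall>m\<ge>N. \<forall>n\<ge>N. dist (B m x) (B n x) < e" by blast
  qed
  then have "\<exists>y. (\<lambda>n. B n x) \<longlonglongrightarrow> y" for x
    using Cauchy_convergent_iff convergent_def by blast
  then obtain C where C: "\<And>x. (\<lambda>n. B n x) \<longlonglongrightarrow> C x" by metis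
  have bcB: "bounded_clinear (B n)" for n
    using B by (simp add: has_spectral_integral_def)
  \<comment> \<open>This one index serves twice: it bounds the limit operator through
    \<open>B N\<close>, and it provides the integrable majorant |f_N| + 1, the scalar measures being
    finite.\<close>
  from unif[of 1] obtain N where N: "\<And>n z. n \<ge> N \<Longrightarrow> z \<in> space M \<Longrightarrow> cmod (f n z - f N z) \<le> 1"
    by (metis order_refl zero_less_one)
  obtain K where K: "\<And>x. norm (B N x) \<le> K * norm x"
    using bounded_clinear_bound[OF bcB] by blast
  have bcC: "bounded_clinear C"
  proof (rule bounded_clinear_intro[where K="2 + K"])
    show "C (x + y) = C x + C y" for x y
      using C[of "x + y"] tendsto_add[OF C[of x] C[of y]]
      by (auto simp: bounded_clinear_add[OF bcB] intro: LIMSEQ_unique)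
    show "C (a *\<^sub>C x) = a *\<^sub>C C x" for a x
      using C[of "a *\<^sub>C x"] bounded_linear.tendsto[OF bounded_linear_scaleC C[of x], of a]
      by (auto simp: bounded_clinear_scaleC[OF bcB] intro: LIMSEQ_unique)
    show "norm (C x) \<le> (2 + K) * norm x" for x
    proof (rule LIMSEQ_le_const2[OF tendsto_norm[OF C]])
      have "norm (B n x) \<le> (2 + K) * norm x" if "n \<ge> N" for n
        using diff[of n N 1 x] N[OF that] norm_triangle_ineq2[of "B n x" "B N x"] K[of x]
        by (simp add: algebra_simps)
      then show "\<exists>N. \<forall>n\<ge>N. norm (B n x) \<le> (2 + K) * norm x" by blast
    qed
  qed
  have "integrable (scalar_measure M E x) h \<and> cinner (C x) x = (LINT z|scalar_measure M E x. h z)" for x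
  proof -
    define \<nu> where "\<nu> = scalar_measure M E x"
    interpret finite_measure \<nu>
      unfolding \<nu>_def by (rule finite_measure_scalar_measure[OF pvm])
    have sp: "space \<nu> = space M" by (simp add: \<nu>_def)
    have int: "integrable \<nu> (f n)" and val: "cinner (B n x) x = (LINT z|\<nu>. f n z)" for n
      using B by (simp_all add: has_spectral_integral_def \<nu>_def)
    have pw: "(\<lambda>n. f n z) \<longlonglongrightarrow> h z" if "z \<in> space M" for z
      using tendsto_uniform_limitI[OF lim that] .
    have h: "h \<in> borel_measurable \<nu>"
      by (rule borel_measurable_LIMSEQ_metric[of f, OF borel_measurable_integrable[OF int]]) (simp add: pw sp)
    have bound: "cmod (f (n + N) z) \<le> cmod (f N z) + 1" if "z \<in> space M" for n z
      using N[of "n + N" z] norm_triangle_ineq2[of "f (n + N) z" "f N z"] that by simp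
    have pw': "AE z in \<nu>. (\<lambda>n. f (n + N) z) \<longlonglongrightarrow> h z"
      by (intro AE_I2 LIMSEQ_ignore_initial_segment pw) (simp add: sp)
    have dom: "integrable \<nu> (\<lambda>z. cmod (f N z) + 1)"
      by (intro Bochner_Integration.integrable_add integrable_norm int integrable_const)
    have bnd: "AE z in \<nu>. cmod (f (n + N) z) \<le> cmod (f N z) + 1" for n
      by (intro AE_I2 bound) (simp add: sp)
    have meas: "(\<lambda>z. f (n + N) z) \<in> borel_measurable \<nu>" for n
      by (rule borel_measurable_integrable[OF int])
    have "(\<lambda>n. LINT z|\<nu>. f (n + N) z) \<longlonglongrightarrow> (LINT z|\<nu>. h z)"
      by (rule integral_dominated_convergence[OF h meas dom pw' bnd])
    moreover have "(\<lambda>n. LINT z|\<nu>. f (n + N) z) \<longlonglongrightarrow> cinner (C x) x"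
      unfolding val[symmetric]
      by (intro LIMSEQ_ignore_initial_segment[of "\<lambda>n. cinner (B n x) x"]
          bounded_linear.tendsto[OF bounded_linear_cinner_left C])
    ultimately have "cinner (C x) x = (LINT z|\<nu>. h z)" by (rule LIMSEQ_unique[rotated])
    moreover have "integrable \<nu> h"
      by (rule integrable_dominated_convergence[OF h meas dom pw' bnd])
    ultimately show ?thesis by (simp add: \<nu>_def)
  qed
  with bcC show ?thesis by (auto simp: has_spectral_integral_def)
qed

text \<open>Real and imaginary parts are rounded down to multiples of 1/(n+1). The error is at most
  2/(n+1) everywhere, and boundedness of f leaves only finitely many values, so f is a uniform limit
  of simple functions.\<close>

lemma has_spectral_integral_bounded:
  fixes E :: "'b set \<Rightarrow> 'a::chilbert_space \<Rightarrow> 'a"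
  assumes pvm: "projection_valued_measure M E"
    and f [measurable]: "f \<in> borel_measurable M"
    and c: "\<And>z. z \<in> space M \<Longrightarrow> cmod (f z) \<le> c"
  shows "\<exists>B. has_spectral_integral M E f B"
proof -
  define h where "h n z = Complex (of_int \<lfloor>real (Suc n) * Re (f z)\<rfloor> / Suc n)
     (of_int \<lfloor>real (Suc n) * Im (f z)\<rfloor> / Suc n)" for n z
  have fl: "\<bar>of_int \<lfloor>real (Suc n) * a\<rfloor> / Suc n - a\<bar> \<le> 1 / Suc n" for n a
  proof -
    have "\<bar>of_int \<lfloor>real (Suc n) * a\<rfloor> - real (Suc n) * a\<bar> \<le> 1" by linarith
    then have "\<bar>of_int \<lfloor>real (Suc n) * a\<rfloor> - real (Suc n) * a\<bar> / Suc n \<le> 1 / Suc n"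
      by (intro divide_right_mono) auto
    also have "\<bar>of_int \<lfloor>real (Suc n) * a\<rfloor> - real (Suc n) * a\<bar> / Suc n =
        \<bar>(of_int \<lfloor>real (Suc n) * a\<rfloor> - real (Suc n) * a) / Suc n\<bar>"
      by simp
    also have "(of_int \<lfloor>real (Suc n) * a\<rfloor> - real (Suc n) * a) / Suc n =
        of_int \<lfloor>real (Suc n) * a\<rfloor> / Suc n - a"
      by (simp add: field_simps del: of_nat_Suc)
    finally show ?thesis .
  qed
  have err: "cmod (h n z - f z) \<le> 2 / Suc n" for n z
  proof -
    have "cmod (h n z - f z) \<le> \<bar>Re (h n z - f z)\<bar> + \<bar>Im (h n z - f z)\<bar>"
      by (rule cmod_le)
    also have "\<dots> \<le> 1 / Suc n + 1 / Suc n"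
      unfolding h_def minus_complex.sel complex.sel by (intro add_mono fl)
    finally show ?thesis by simp
  qed
  have "simple_function M (h n)" for n
    unfolding simple_function_def
  proof (intro conjI ballI)
    \<comment> \<open>All numerators that can occur in either coordinate, given that both are at
      most c in absolute value.\<close>
    define J where "J = {\<lfloor>real (Suc n) * (- c)\<rfloor>..\<lfloor>real (Suc n) * c\<rfloor>}"
    have "\<lfloor>real (Suc n) * a\<rfloor> \<in> J" if "\<bar>a\<bar> \<le> c" for a
      using that unfolding J_def atLeastAtMost_iff by (intro conjI floor_mono mult_left_mono) auto
    then have "h n ` space M \<subseteq> (\<lambda>(j, k). Complex (of_int j / Suc n) (of_int k / Suc n)) ` (J \<times> J)"
      unfolding h_def
      by (auto intro!: image_eqI[of _ _ "(_, _)"] intro: order_trans[OF abs_Re_le_cmod c]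
          order_trans[OF abs_Im_le_cmod c])
    moreover have "finite (J \<times> J)" unfolding J_def by simp
    ultimately show "finite (h n ` space M)" by (meson finite_imageI finite_subset)
    have "h n \<in> borel_measurable M"
      unfolding h_def[abs_def] borel_measurable_complex_iff by simp
    then show "h n -` {y} \<inter> space M \<in> sets M" for y
      by (rule measurable_sets) simp
  qed
  then have "\<exists>B. \<forall>n. has_spectral_integral M E (h n) (B n)"
    by (intro choice allI has_spectral_integral_simple_function[OF pvm])
  then obtain B where B: "\<And>n. has_spectral_integral M E (h n) (B n)" by blast
  have "uniform_limit (space M) h f sequentially"
  proof (rule uniform_limitI)
    fix e :: real assume "e > 0"
    have "(\<lambda>n. 2 / real (Suc n)) \<longlonglongrightarrow> 0"
      using tendsto_mult_right_zero[OF LIMSEQ_inverse_real_of_nat, of 2] by (simp add: divide_inverse)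
    then have "\<forall>\<^sub>F n in sequentially. 2 / real (Suc n) < e"
      using \<open>e > 0\<close> by (rule order_tendstoD)
    then show "\<forall>\<^sub>F n in sequentially. \<forall>z\<in>space M. dist (h n z) (f z) < e"
      by eventually_elim (metis dist_norm err le_less_trans)
  qed
  then show ?thesis by (rule has_spectral_integral_uniform_limit[OF pvm B])
qed

lemma has_spectral_integral_adjoint:
  assumes B: "has_spectral_integral M E f B" and C: "has_spectral_integral M E (\<lambda>z. cnj (f z)) C"
  shows "cinner x (B y) = cinner (C x) y"
  using B C by (intro adjoint_from_quadratic_form) (auto simp: has_spectral_integral_def)

section \<open>Regularity of the scalar powers in t and in z\<close>

section \<open>Powers on the spectrum\<close>

text \<open>The mean value inequality: the derivative w exp(tw) has modulus at most R exp(LR) on the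
  interval.\<close>

lemma norm_exp_diff_le:
  fixes w :: complex
  assumes "cmod w \<le> R" and "s \<in> {0..L}" "t \<in> {0..L}"
  shows "cmod (exp (of_real t * w) - exp (of_real s * w)) \<le> R * exp (L * R) * \<bar>t - s\<bar>"
proof -
  have R: "0 \<le> R" using assms(1) norm_ge_zero order_trans by blast
  have "norm (exp (of_real t * w) - exp (of_real s * w)) \<le> R * exp (L * R) * norm (t - s)"
  proof (rule differentiable_bound[where S="{0..L}" and f="\<lambda>t. exp (of_real t * w)"
        and f'="\<lambda>t h. h *\<^sub>R (w * exp (of_real t * w))"])
    fix x assume x: "x \<in> {0..L}"
    have "((\<lambda>t. exp (of_real t * w)) has_vector_derivative w * exp (of_real x * w)) (at x within {0..L})"
      by (rule has_vector_derivative_real_field[of "\<lambda>z. exp (z * w)"])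
        (auto intro!: derivative_eq_intros)
    then show "((\<lambda>t. exp (of_real t * w)) has_derivative (\<lambda>h. h *\<^sub>R (w * exp (of_real x * w))))
        (at x within {0..L})"
      by (simp add: has_vector_derivative_def)
    have "norm (exp (of_real x * w)) \<le> exp (norm (of_real x * w))" by (rule norm_exp)
    also have "\<dots> \<le> exp (L * R)"
      using x assms(1) R by (auto simp: norm_mult intro!: mult_mono)
    finally have "norm (w * exp (of_real x * w)) \<le> R * exp (L * R)"
      using assms(1) R by (simp add: norm_mult mult_mono)
    then show "onorm (\<lambda>h. h *\<^sub>R (w * exp (of_real x * w))) \<le> R * exp (L * R)"
      by (intro onorm_le) (auto simp: mult.commute[of "R * _"] intro!: mult_left_mono)
  qed (use assms in auto)
  then show ?thesis by simp
qed

text \<open>The exponent ln|z| + i arg z has modulus at most c, since ln|z| lies between ln r and ln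
  R and the argument is at most pi in modulus. The constant is therefore uniform over the
  annulus.\<close>

lemma branch_power_Lipschitz:
  assumes r: "0 < r" "r \<le> cmod z" and R: "cmod z \<le> R" and "s \<in> {0..L}" "t \<in> {0..L}"
  defines "c \<equiv> \<bar>ln r\<bar> + \<bar>ln R\<bar> + pi"
  shows "cmod (branch_power z t - branch_power z s) \<le> c * exp (L * c) * \<bar>t - s\<bar>"
  unfolding branch_power_def
proof (rule norm_exp_diff_le)
  have "ln r \<le> ln (cmod z)" "ln (cmod z) \<le> ln R"
    using r R by (auto intro!: ln_le_cancel_iff[THEN iffD2])
  then have "\<bar>ln (cmod z)\<bar> \<le> \<bar>ln r\<bar> + \<bar>ln R\<bar>" by linarith
  moreover have "\<bar>arg_low z\<bar> \<le> pi"
    using Arg_bounded[of z] by (auto simp: arg_low_def)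
  ultimately show "cmod (complex_of_real (ln (cmod z)) + \<i> * complex_of_real (arg_low z)) \<le> c"
    unfolding c_def by (intro order_trans[OF norm_triangle_ineq]) (simp add: norm_mult)
qed (use assms in auto)

lemma branch_power_0 [simp]: "branch_power z 0 = 1"
  by (simp add: branch_power_def)

lemma branch_power_measurable: "(\<lambda>z. branch_power z t) \<in> borel_measurable borel"
proof -
  have Arg: "Arg \<in> borel_measurable borel"
  proof -
    have "Arg = (\<lambda>z. if z = 0 then 0 else Im (Ln z))"
      by (rule ext) (simp add: Arg_def)
    moreover have "(\<lambda>z. if z = 0 then 0 else Im (Ln z)) \<in> borel_measurable borel"
      by measurable
    ultimately show ?thesis by metis
  qed
  have "(\<lambda>a::real. if a = pi then - pi else a) \<in> borel_measurable borel"
    by measurable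
  from measurable_compose[OF Arg this] have "arg_low \<in> borel_measurable borel"
    by (simp add: arg_low_def[abs_def])
  moreover have "(\<lambda>z::complex. ln (cmod z)) \<in> borel_measurable borel"
    by (rule borel_measurable_ln[OF borel_measurable_norm])
  ultimately show ?thesis
    unfolding branch_power_def
    by (intro measurable_compose[OF _ borel_measurable_exp] measurable_compose[OF _ borel_measurable_of_real]
        borel_measurable_times borel_measurable_add borel_measurable_const)
qed

section \<open>Reduction to finite subsystems, and both implications for an abstract operator
  family\<close>

section \<open>Bessel systems\<close>

text \<open>A sum in [0, \<infinity>] is the supremum of its finite partial sums. This reduces both
  Bessel conditions to finite subsystems with a common constant.\<close>

lemma infsum_ennreal_le_iff:
  fixes f :: "'i \<Rightarrow> ennreal"
  shows "infsum f I \<le> c \<longleftrightarrow> (\<forall>F. finite F \<and> F \<subseteq> I \<longrightarrow> sum f F \<le> c)"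
proof
  assume le: "infsum f I \<le> c"
  show "\<forall>F. finite F \<and> F \<subseteq> I \<longrightarrow> sum f F \<le> c"
  proof (intro allI impI)
    fix F assume F: "finite F \<and> F \<subseteq> I"
    then have "sum f F = infsum f F" by simp
    also have "\<dots> \<le> infsum f I"
      by (rule infsum_mono_neutral) (use F in \<open>auto intro: nonneg_summable_on_complete\<close>)
    finally show "sum f F \<le> c" using le by simp
  qed
next
  assume "\<forall>F. finite F \<and> F \<subseteq> I \<longrightarrow> sum f F \<le> c"
  then show "infsum f I \<le> c"
    by (intro infsum_le_finite_sums nonneg_summable_on_complete) auto
qed

lemma bessel_system_iff:
  "bessel_system g I \<longleftrightarrow> (\<exists>C>0. \<forall>F f. finite F \<and> F \<subseteq> I \<longrightarrow>
     (\<Sum>i\<in>F. (cmod (cinner f (g i)))\<^sup>2) \<le> C * (norm f)\<^sup>2)"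
proof -
  have "(\<Sum>i\<in>F. ennreal ((cmod (cinner f (g i)))\<^sup>2)) \<le> ennreal (C * (norm f)\<^sup>2) \<longleftrightarrow>
      (\<Sum>i\<in>F. (cmod (cinner f (g i)))\<^sup>2) \<le> C * (norm f)\<^sup>2" if "C > 0" for F f C
    using that by (simp add: sum_ennreal ennreal_le_iff)
  then show ?thesis
    unfolding bessel_system_def infsum_ennreal_le_iff
    by (intro ex_cong1 conj_cong refl) auto
qed

text \<open>The optimal constant of \<open>Q\<close> is finite because of \<open>k\<^sub>0\<close>, so that the self-improving
  estimate may be applied to it.\<close>

lemma absorb_quadratic_bound:
  fixes Q :: "'a::real_normed_vector \<Rightarrow> real"
  assumes k0: "\<And>f. Q f \<le> k\<^sub>0 * (norm f)\<^sup>2" and Q: "\<And>f. 0 \<le> Q f" and c: "0 \<le> c"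
    and improve: "\<And>k. 0 \<le> k \<Longrightarrow> (\<And>f. Q f \<le> k * (norm f)\<^sup>2) \<Longrightarrow> (\<And>f. Q f \<le> (c + k / 2) * (norm f)\<^sup>2)"
  shows "Q f \<le> 2 * c * (norm f)\<^sup>2"
proof -
  \<comment> \<open>At f = 0 the quotient is 0, as division by zero gives 0; this yields
    \<open>0 \<le> k\<close>. That \<open>Q 0\<close> is at most 0 comes from the a priori bound
    instead.\<close>
  define k where "k = (SUP f. Q f / (norm f)\<^sup>2)"
  have bdd: "bdd_above (range (\<lambda>f. Q f / (norm f)\<^sup>2))"
  proof (rule bdd_aboveI2)
    show "Q f / (norm f)\<^sup>2 \<le> max 0 k\<^sub>0" for f
      using k0[of f] by (cases "f = 0") (auto simp: field_simps le_max_iff_disj)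
  qed
  have le: "Q f / (norm f)\<^sup>2 \<le> k" for f
    unfolding k_def by (rule cSUP_upper[OF _ bdd]) simp
  have Qk: "Q f \<le> k * (norm f)\<^sup>2" for f
    using le[of f] k0[of f] by (cases "f = 0") (auto simp: field_simps)
  have k: "0 \<le> k" using le[of 0] by simp
  have "k \<le> c + k / 2"
    unfolding k_def
  proof (rule cSUP_least)
    show "Q f / (norm f)\<^sup>2 \<le> c + (SUP f. Q f / (norm f)\<^sup>2) / 2" for f
      using improve[OF k Qk, of f] c k unfolding k_def[symmetric]
      by (cases "f = 0") (auto simp: field_simps)
  qed simp
  then have "k \<le> 2 * c" by simp
  then show ?thesis using Qk[of f] by (meson mult_right_mono order_trans zero_le_power2)
qed

text \<open>Isolates what the Bessel argument takes from the functional calculus. The adjoint moves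
  the operator from the vectors of the system to f, so that the fixed system is tested against
  \<open>S t f\<close>.\<close>

locale Lipschitz_adjoint_family =
  fixes T S :: "real \<Rightarrow> 'a::complex_inner \<Rightarrow> 'a" and K L :: real
  assumes adjoint: "\<And>t x y. t \<in> {0..L} \<Longrightarrow> cinner x (T t y) = cinner (S t x) y"
    and Lipschitz: "\<And>s t x. s \<in> {0..L} \<Longrightarrow> t \<in> {0..L} \<Longrightarrow> norm (S t x - S s x) \<le> K * \<bar>t - s\<bar> * norm x"
    and S0: "S 0 x = x"
    and L: "L > 0" and K: "K > 0"
begin

text \<open>By the adjoint relation the coefficient is \<open>cinner (S t f) x\<close>, which is
  continuous in t on [0, L]. The indicator is there because nothing is known outside that
  interval.\<close>

lemma coefficient_measurable:
  "(\<lambda>t. indicator {0..L} t * ennreal ((cmod (cinner f (T t x)))\<^sup>2)) \<in> borel_measurable borel"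
proof -
  have "continuous_on {0..L} (\<lambda>t. cinner (S t f) x)"
  proof (rule continuous_on_compose2[OF linear_continuous_on[OF bounded_linear_cinner_left] _ subset_UNIV])
    have "(K * norm f)-lipschitz_on {0..L} (\<lambda>t. S t f)"
      using Lipschitz K by (intro lipschitz_onI) (auto simp: dist_norm mult_ac)
    then show "continuous_on {0..L} (\<lambda>t. S t f)" by (rule lipschitz_on_continuous_on)
  qed
  then have "continuous_on {0..L} (\<lambda>t. (cmod (cinner (S t f) x))\<^sup>2)"
    by (intro continuous_intros)
  then have "(\<lambda>t. indicator {0..L} t *\<^sub>R (cmod (cinner (S t f) x))\<^sup>2) \<in> borel_measurable borel"
    by (rule borel_measurable_continuous_on_indicator[rotated]) simp
  then have meas: "(\<lambda>t. ennreal (indicator {0..L} t *\<^sub>R (cmod (cinner (S t f) x))\<^sup>2))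
      \<in> borel_measurable borel"
    by measurable
  have eq: "ennreal (indicator {0..L} t *\<^sub>R (cmod (cinner (S t f) x))\<^sup>2) =
      indicator {0..L} t * ennreal ((cmod (cinner f (T t x)))\<^sup>2)" for t
    using adjoint by (auto simp: indicator_def)
  show ?thesis using meas unfolding eq .
qed

lemma sum_nn_integral:
  "(\<Sum>i\<in>F. \<integral>\<^sup>+t\<in>{0..L}. ennreal ((cmod (cinner f (T t (g i))))\<^sup>2) \<partial>lborel) =
    (\<integral>\<^sup>+t\<in>{0..L}. ennreal (\<Sum>i\<in>F. (cmod (cinner (S t f) (g i)))\<^sup>2) \<partial>lborel)"
proof -
  have "(\<Sum>i\<in>F. \<integral>\<^sup>+t\<in>{0..L}. ennreal ((cmod (cinner f (T t (g i))))\<^sup>2) \<partial>lborel) =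
      (\<integral>\<^sup>+t. (\<Sum>i\<in>F. ennreal ((cmod (cinner f (T t (g i))))\<^sup>2) * indicator {0..L} t) \<partial>lborel)"
    using coefficient_measurable by (intro nn_integral_sum[symmetric]) (simp add: mult.commute)
  also have "\<dots> = (\<integral>\<^sup>+t\<in>{0..L}. ennreal (\<Sum>i\<in>F. (cmod (cinner (S t f) (g i)))\<^sup>2) \<partial>lborel)"
    by (intro nn_integral_cong) (auto simp: indicator_def adjoint)
  finally show ?thesis .
qed

lemma semicontinuous_bessel_system_iff':
  "semicontinuous_bessel_system (\<lambda>i t. T t (g i)) I L \<longleftrightarrow> (\<exists>C>0. \<forall>F f. finite F \<and> F \<subseteq> I \<longrightarrow>
     (\<integral>\<^sup>+t\<in>{0..L}. ennreal (\<Sum>i\<in>F. (cmod (cinner (S t f) (g i)))\<^sup>2) \<partial>lborel) \<le> ennreal (C * (norm f)\<^sup>2))"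
  unfolding semicontinuous_bessel_system_def infsum_ennreal_le_iff sum_nn_integral
  by (intro ex_cong1 conj_cong refl) auto

lemma semicontinuous_bessel_system_if:
  assumes "bessel_system g I"
  shows "semicontinuous_bessel_system (\<lambda>i t. T t (g i)) I L"
proof -
  obtain C where C: "C > 0" "\<And>F f. finite F \<Longrightarrow> F \<subseteq> I \<Longrightarrow>
      (\<Sum>i\<in>F. (cmod (cinner f (g i)))\<^sup>2) \<le> C * (norm f)\<^sup>2"
    using assms unfolding bessel_system_iff by blast
  \<comment> \<open>A bound for all \<open>S t\<close> on [0, L]: the Lipschitz estimate is started
    at \<open>S 0\<close>, the identity.\<close>
  define M where "M = 1 + K * L"
  have M: "M > 0" using K L by (simp add: M_def add_pos_pos)
  have SM: "norm (S t f) \<le> M * norm f" if t: "t \<in> {0..L}" for t f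
  proof -
    have "norm (S t f) \<le> norm f + norm (S t f - f)"
      by (metis norm_triangle_sub)
    also have "\<dots> \<le> norm f + K * t * norm f"
      using Lipschitz[of 0 t f] t L by (simp add: S0)
    also have "\<dots> \<le> norm f + K * L * norm f"
      using t K by (intro add_left_mono mult_right_mono mult_left_mono) auto
    finally show ?thesis by (simp add: M_def algebra_simps)
  qed
  show ?thesis
    unfolding semicontinuous_bessel_system_iff'
  proof (intro exI[of _ "C * M\<^sup>2 * L"] conjI allI impI)
    show "C * M\<^sup>2 * L > 0" using C(1) M L by simp
    fix F f assume F: "finite F \<and> F \<subseteq> I"
    have "(\<integral>\<^sup>+t\<in>{0..L}. ennreal (\<Sum>i\<in>F. (cmod (cinner (S t f) (g i)))\<^sup>2) \<partial>lborel) \<le>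
        (\<integral>\<^sup>+t\<in>{0..L}. ennreal (C * (M * norm f)\<^sup>2) \<partial>lborel)"
    proof (intro nn_integral_mono)
      fix t
      have "(\<Sum>i\<in>F. (cmod (cinner (S t f) (g i)))\<^sup>2) \<le> C * (M * norm f)\<^sup>2" if "t \<in> {0..L}"
        using C(2)[of F "S t f"] F power_mono[OF SM[OF that, of f], of 2] C(1)
        by (auto intro: order_trans mult_left_mono)
      then show "ennreal (\<Sum>i\<in>F. (cmod (cinner (S t f) (g i)))\<^sup>2) * indicator {0..L} t \<le>
          ennreal (C * (M * norm f)\<^sup>2) * indicator {0..L} t"
        by (auto simp: indicator_def intro: ennreal_leI)
    qed
    also have "\<dots> = ennreal (C * (M * norm f)\<^sup>2) * ennreal L"
      using L by (simp add: nn_integral_cmult_indicator)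
    also have "\<dots> = ennreal (C * M\<^sup>2 * L * (norm f)\<^sup>2)"
      using L C(1) by (simp add: ennreal_mult[symmetric] power_mult_distrib mult_ac)
    finally show "(\<integral>\<^sup>+t\<in>{0..L}. ennreal (\<Sum>i\<in>F. (cmod (cinner (S t f) (g i)))\<^sup>2) \<partial>lborel) \<le>
        ennreal (C * M\<^sup>2 * L * (norm f)\<^sup>2)" .
  qed
qed

lemma bessel_system_if:
  assumes "semicontinuous_bessel_system (\<lambda>i t. T t (g i)) I L"
  shows "bessel_system g I"
proof -
  obtain C where C: "C > 0" "\<And>F f. finite F \<Longrightarrow> F \<subseteq> I \<Longrightarrow>
     (\<integral>\<^sup>+t\<in>{0..L}. ennreal (\<Sum>i\<in>F. (cmod (cinner (S t f) (g i)))\<^sup>2) \<partial>lborel) \<le> ennreal (C * (norm f)\<^sup>2)"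
    using assms unfolding semicontinuous_bessel_system_iff' by blast
  \<comment> \<open>Chosen so that f - S(t) f has norm at most half that of f for t up to \<delta>.
    Squared this gives 1/4, and after the factor 2 from splitting the square, the term k/2 to be
    absorbed.\<close>
  define \<delta> where "\<delta> = min L (1 / (2 * K))"
  have \<delta>: "0 < \<delta>" "\<delta> \<le> L" "K * \<delta> \<le> 1 / 2"
    using L K by (auto simp: \<delta>_def min_def field_simps)
  show ?thesis
    unfolding bessel_system_iff
  \<comment> \<open>Integration over [0, \<delta>] and division by \<delta> leave 2C/\<delta>;
    absorbing k/2 doubles it. The result does not depend on F.\<close>
  proof (intro exI[of _ "2 * (2 * C / \<delta>)"] conjI allI impI)
    show "2 * (2 * C / \<delta>) > 0" using C(1) \<delta>(1) by simp
    fix F f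
    assume F: "finite F \<and> F \<subseteq> I"
    define Q where "Q f = (\<Sum>i\<in>F. (cmod (cinner f (g i)))\<^sup>2)" for f
    have Q0: "0 \<le> Q f" for f unfolding Q_def by (intro sum_nonneg) simp
    have "Q f \<le> 2 * (2 * C / \<delta>) * (norm f)\<^sup>2"
    proof (rule absorb_quadratic_bound[of Q "\<Sum>i\<in>F. (2 * norm (g i))\<^sup>2", OF _ Q0])
      \<comment> \<open>This a priori bound depends on F and serves only to make the optimal
        constant finite.\<close>
      show "Q f \<le> (\<Sum>i\<in>F. (2 * norm (g i))\<^sup>2) * (norm f)\<^sup>2" for f
        unfolding Q_def sum_distrib_right power_mult_distrib[symmetric]
        by (intro sum_mono power_mono) (simp_all add: order_trans[OF cmod_cinner_le] mult_ac)
      show "0 \<le> 2 * C / \<delta>" using C(1) \<delta>(1) by simp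
      fix k f assume k: "0 \<le> k" and Qk: "\<And>f. Q f \<le> k * (norm f)\<^sup>2"
      have step: "Q f \<le> 2 * Q (S t f) + k / 2 * (norm f)\<^sup>2" if t: "t \<in> {0..\<delta>}" for t
      proof -
        have sq: "(cmod (a + b))\<^sup>2 \<le> 2 * (cmod a)\<^sup>2 + 2 * (cmod b)\<^sup>2" for a b :: complex
        proof -
          have "(cmod (a + b))\<^sup>2 \<le> (cmod a + cmod b)\<^sup>2"
            by (intro power_mono norm_triangle_ineq) simp
          also have "\<dots> \<le> 2 * (cmod a)\<^sup>2 + 2 * (cmod b)\<^sup>2"
            using zero_le_power2[of "cmod a - cmod b"] by (simp add: power2_eq_square algebra_simps)
          finally show ?thesis .
        qed
        have "Q f = (\<Sum>i\<in>F. (cmod (cinner (S t f) (g i) + cinner (f - S t f) (g i)))\<^sup>2)"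
          by (simp add: Q_def cinner_simps)
        also have "\<dots> \<le> 2 * Q (S t f) + 2 * Q (f - S t f)"
          unfolding Q_def sum_distrib_left sum.distrib[symmetric] by (intro sum_mono sq)
        also have "Q (f - S t f) \<le> k / 4 * (norm f)\<^sup>2"
        proof -
          have "norm (f - S t f) \<le> K * t * norm f"
            using Lipschitz[of t 0 f] t \<delta> by (simp add: S0)
          also have "\<dots> \<le> 1 / 2 * norm f"
            using t K \<delta>(3) by (intro mult_right_mono order_trans[OF mult_left_mono \<delta>(3)]) auto
          finally have "(norm (f - S t f))\<^sup>2 \<le> (1 / 2 * norm f)\<^sup>2"
            by (intro power_mono) auto
          then have "k * (norm (f - S t f))\<^sup>2 \<le> k * (1 / 2 * norm f)\<^sup>2"
            using k by (intro mult_left_mono)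
          then show ?thesis using Qk[of "f - S t f"] by (simp add: power_divide)
        qed
        finally show ?thesis by simp
      qed
      \<comment> \<open>\<open>Q f\<close> does not depend on t, so integrating the pointwise
        estimate over [0, \<delta>] gives \<delta> times it. On the right, the main term is enlarged
        to [0, L], where the semicontinuous Bessel bound applies.\<close>
      have "ennreal (\<delta> * Q f) = (\<integral>\<^sup>+t\<in>{0..\<delta>}. ennreal (Q f) \<partial>lborel)"
        using \<delta>(1) Q0 by (simp add: nn_integral_cmult_indicator ennreal_mult mult.commute)
      also have "\<dots> \<le> (\<integral>\<^sup>+t. 2 * (ennreal (Q (S t f)) * indicator {0..L} t)
          + ennreal (k / 2 * (norm f)\<^sup>2) * indicator {0..\<delta>} t \<partial>lborel)"
      proof (intro nn_integral_mono)
        fix t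
        have "ennreal (Q f) \<le> 2 * ennreal (Q (S t f)) + ennreal (k / 2 * (norm f)\<^sup>2)" if "t \<in> {0..\<delta>}"
        proof -
          have "ennreal (Q f) \<le> ennreal (2 * Q (S t f) + k / 2 * (norm f)\<^sup>2)"
            by (rule ennreal_leI[OF step[OF that]])
          also have "\<dots> = ennreal 2 * ennreal (Q (S t f)) + ennreal (k / 2 * (norm f)\<^sup>2)"
            using Q0 k by (simp add: ennreal_plus ennreal_mult')
          finally show ?thesis by simp
        qed
        then show "ennreal (Q f) * indicator {0..\<delta>} t \<le> 2 * (ennreal (Q (S t f)) * indicator {0..L} t)
            + ennreal (k / 2 * (norm f)\<^sup>2) * indicator {0..\<delta>} t"
          using \<delta>(2) by (auto simp: indicator_def)
      qed
      also have "\<dots> = 2 * (\<integral>\<^sup>+t\<in>{0..L}. ennreal (Q (S t f)) \<partial>lborel)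
          + ennreal (k / 2 * (norm f)\<^sup>2) * ennreal \<delta>"
      proof -
        have "(\<lambda>t. \<Sum>i\<in>F. indicator {0..L} t * ennreal ((cmod (cinner f (T t (g i))))\<^sup>2))
            \<in> borel_measurable lborel"
          using coefficient_measurable by simp
        moreover have "(\<Sum>i\<in>F. indicator {0..L} t * ennreal ((cmod (cinner f (T t (g i))))\<^sup>2)) =
            ennreal (Q (S t f)) * indicator {0..L} t" for t
          by (auto simp: indicator_def Q_def adjoint)
        ultimately have "(\<lambda>t. ennreal (Q (S t f)) * indicator {0..L} t) \<in> borel_measurable lborel"
          by simp
        then show ?thesis
          using \<delta>(1) by (simp add: nn_integral_add nn_integral_cmult nn_integral_cmult_indicator)
      qed
      also have "\<dots> \<le> 2 * ennreal (C * (norm f)\<^sup>2) + ennreal (k / 2 * (norm f)\<^sup>2) * ennreal \<delta>"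
        using C(2)[of F f] F by (intro add_right_mono mult_left_mono) (auto simp: Q_def)
      also have "\<dots> = ennreal (2 * (C * (norm f)\<^sup>2) + k / 2 * (norm f)\<^sup>2 * \<delta>)"
      proof -
        have "2 * ennreal (C * (norm f)\<^sup>2) = ennreal (2 * (C * (norm f)\<^sup>2))"
          using C(1) by (intro numeral_mult_ennreal) simp
        moreover have "ennreal (k / 2 * (norm f)\<^sup>2) * ennreal \<delta> = ennreal (k / 2 * (norm f)\<^sup>2 * \<delta>)"
          using k \<delta>(1) by (intro ennreal_mult[symmetric]) auto
        ultimately show ?thesis
          using C(1) k \<delta>(1) by (simp only:) (intro ennreal_plus[symmetric], auto)
      qed
      finally have "\<delta> * Q f \<le> 2 * (C * (norm f)\<^sup>2) + k / 2 * (norm f)\<^sup>2 * \<delta>"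
        using C(1) k \<delta>(1) by (subst (asm) ennreal_le_iff) auto
      then have "\<delta> * Q f \<le> \<delta> * ((2 * C / \<delta> + k / 2) * (norm f)\<^sup>2)"
        using \<delta>(1) by (simp add: algebra_simps)
      then show "Q f \<le> (2 * C / \<delta> + k / 2) * (norm f)\<^sup>2"
        using \<delta>(1) by simp
    qed
    then show "(\<Sum>i\<in>F. (cmod (cinner f (g i)))\<^sup>2) \<le> 2 * (2 * C / \<delta>) * (norm f)\<^sup>2"
      by (simp add: Q_def)
  qed
qed

end

section \<open>The powers of A satisfy the abstract conditions\<close>

section \<open>Real powers of an operator\<close>

theorem theorem4p3:
  fixes A :: "'a::chilbert_space \<Rightarrow> 'a"
    and E :: "complex set \<Rightarrow> 'a \<Rightarrow> 'a"
    and g :: "'i \<Rightarrow> 'a" and I :: "'i set"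
    and L :: real
  assumes "separable_space (euclidean :: 'a topology)"
    and "bounded_clinear A" and "invertible_op A" and "normal_op A"
    and "spectral_measure_of A E"
    and "countable I"
    and "L > 0"
  shows "semicontinuous_bessel_system (\<lambda>i t. op_power A E t (g i)) I L \<longleftrightarrow> bessel_system g I"
proof -
  define M where "M = borel_spectrum A"
  have space_M: "space M = op_spectrum A"
    by (simp add: M_def space_restrict_space)
  have pvm: "projection_valued_measure M E"
    using assms(5) by (simp add: spectral_measure_of_def M_def)
  obtain R where R: "R > 0" "\<And>x. norm (A x) \<le> R * norm x"
    using bounded_clinear_bound[OF assms(2)] by blast
  obtain r where r: "r > 0" "\<And>z. z \<in> op_spectrum A \<Longrightarrow> r \<le> cmod z"
    using spectrum_lower_bound[OF assms(2,3)] by blast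
  define c where "c = \<bar>ln r\<bar> + \<bar>ln R\<bar> + pi"
  define K where "K = c * exp (L * c)"
  have "c > 0" unfolding c_def using pi_gt_zero by linarith
  then have K: "K > 0" by (simp add: K_def)
  have Lipschitz: "cmod (branch_power z t - branch_power z s) \<le> K * \<bar>t - s\<bar>"
    if "z \<in> space M" "s \<in> {0..L}" "t \<in> {0..L}" for z s t
    unfolding K_def c_def
    using that r(2)[of z] spectrum_upper_bound[OF assms(2) R, of z]
    by (intro branch_power_Lipschitz r(1)) (simp_all add: space_M)
  \<comment> \<open>The adjoint of the power of A, obtained by conjugating the integrand.\<close>
  define S where "S t = spectral_integral M E (\<lambda>z. cnj (branch_power z t))" for t
  have bound: "cmod (branch_power z t) \<le> 1 + K * L" if "z \<in> space M" "t \<in> {0..L}" for z t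
  proof -
    have "cmod (branch_power z t) \<le> 1 + cmod (branch_power z t - 1)"
      using norm_triangle_sub[of "branch_power z t" 1] by simp
    also have "cmod (branch_power z t - 1) \<le> K * t"
      using Lipschitz[of z 0 t] that assms(7) by simp
    also have "K * t \<le> K * L" using K that by simp
    finally show ?thesis by simp
  qed
  have meas: "(\<lambda>z. branch_power z t) \<in> borel_measurable M" for t
    unfolding M_def by (rule measurable_restrict_space1[OF branch_power_measurable])
  \<comment> \<open>\<open>op_power\<close> is a definite description, so existence of the integral
    must be shown before it means anything; on [0, L] the integrand is a bounded Borel
    function.\<close>
  have T: "has_spectral_integral M E (\<lambda>z. branch_power z t) (op_power A E t)" if t: "t \<in> {0..L}" for t
  proof -
    obtain B where B: "has_spectral_integral M E (\<lambda>z. branch_power z t) B"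
      using has_spectral_integral_bounded[OF pvm meas bound[OF _ t]] by blast
    then have "op_power A E t = B"
      unfolding op_power_def M_def[symmetric] by (rule spectral_integral_eqI)
    with B show ?thesis by simp
  qed
  have S: "has_spectral_integral M E (\<lambda>z. cnj (branch_power z t)) (S t)" if t: "t \<in> {0..L}" for t
  proof -
    have "(\<lambda>z. cnj (branch_power z t)) \<in> borel_measurable M"
      by (intro measurable_compose[OF meas] borel_measurable_continuous_onI continuous_intros)
    moreover have "cmod (cnj (branch_power z t)) \<le> 1 + K * L" if "z \<in> space M" for z
      using bound[OF that t] by simp
    ultimately obtain B where B: "has_spectral_integral M E (\<lambda>z. cnj (branch_power z t)) B"
      using has_spectral_integral_bounded[OF pvm] by blast
    then have "S t = B"
      unfolding S_def by (rule spectral_integral_eqI)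
    with B show ?thesis by simp
  qed
  \<comment> \<open>The scalar Lipschitz constant K becomes 2K for operators through the factor 2 in
    the norm estimate.\<close>
  interpret Lipschitz_adjoint_family "op_power A E" S "2 * K" L
  proof
    show "cinner x (op_power A E t y) = cinner (S t x) y" if "t \<in> {0..L}" for t x y
      by (rule has_spectral_integral_adjoint[OF T[OF that] S[OF that]])
    show "norm (S t x - S s x) \<le> 2 * K * \<bar>t - s\<bar> * norm x" if "s \<in> {0..L}" "t \<in> {0..L}" for s t x
    proof -
      have "cmod (cnj (branch_power z t) - cnj (branch_power z s)) \<le> K * \<bar>t - s\<bar>" if "z \<in> space M" for z
        using Lipschitz[OF that \<open>s \<in> {0..L}\<close> \<open>t \<in> {0..L}\<close>]
        unfolding complex_cnj_diff[symmetric] complex_mod_cnj .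
      from has_spectral_integral_norm_le[OF pvm has_spectral_integral_diff[OF S S] this] that
      show ?thesis by (simp add: mult.assoc)
    qed
    show "S 0 x = x" for x
    proof -
      have "E (space M) = id"
        using pvm by (simp add: projection_valued_measure_def)
      then have "has_spectral_integral M E (indicator (space M)) id"
        using has_spectral_integral_indicator[OF pvm sets.top] by simp
      \<comment> \<open>At t = 0 the integrand is 1, the indicator of the whole spectrum, whose
        projection is the identity.\<close>
      then have "has_spectral_integral M E (\<lambda>z. cnj (branch_power z 0)) id"
        by (subst has_spectral_integral_cong[where h="indicator (space M)"]) simp_all
      then have "S 0 = id" unfolding S_def by (rule spectral_integral_eqI)
      then show ?thesis by simp
    qed
    show "L > 0" "2 * K > 0" using assms(7) K by simp_all
  qed
  show ?thesis
    using semicontinuous_bessel_system_if bessel_system_if by blast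
qed

end
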